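(* Let $G$ be a finite group, $\sigma\in\mathrm{Aut}(G)$ of order $k$, and $a\in G$ an element of order $t$. Let $\mathcal{O}_a=\{a^\mu : \mu\in\langle\sigma\rangle\}$ and assume that $|\mathcal{O}_a|=k$ and that $\langle a\rangle\neq\langle a^{\sigma^i}\rangle$ for every $1\le i\le k-1$. Put $\mathbf{y}_i=\langle a^{\sigma^i}\rangle$ for $1\le i\le k$, $X=\{\langle b\rangle : b\in\mathcal{O}_a\}=\{\mathbf{y}_1,\ldots,\mathbf{y}_k\}$, $\rho_X=(\mathbf{y}_1,\mathbf{y}_2,\ldots,\mathbf{y}_k)$, $\tau_i=(1_G,a^{\sigma^i},(a^2)^{\sigma^i},\ldots,(a^{t-1})^{\sigma^i})$ for $1\le i\le k$, and let $\mathcal{M}=\mathrm{CM}(G,X,\rho_X,\tau_{[k]})$ be the corresponding Cayley hypermap, with underlying hypergraph $\Gamma=\mathrm{CH}(G,X)$. Suppose that $\langle\mathcal{O}_a\rangle=G$. Then $\mathcal{M}$ is a regular Cayley hypermap, its underlying hypergraph $\Gamma$ is simple, and $\mathrm{Aut}(\mathcal{M})=\langle\sigma\rangle G_R$.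
   Context: Permutations act on the right; $[r]=\{1,\ldots,r\}$. Subsets $\mathbf{x},\mathbf{y}$ of $G$ containing $1_G$ are Cayley equivalent if $\mathbf{x}g^{-1}=\mathbf{y}$ for some $g\in\mathbf{x}$. A set $Y=\{\mathbf{y}_1,\ldots,\mathbf{y}_r\}$ of subsets of $G$ containing $1_G$ is a non-Cayley equivalent hyperset if no two different elements of $Y$ are Cayley equivalent. Put $[Y]=\{\mathbf{y}g^{-1} : \mathbf{y}\in Y, g\in\mathbf{y}\}$. $\mathrm{CH}(G,Y)$ is the hypergraph with vertex set $G$ and edge set $\{\mathbf{y}g : \mathbf{y}\in Y, g\in G\}$, with arc set $D=\{(g,\mathbf{x}g) : g\in G,\mathbf{x}\in[Y]\}=\{(ah,\mathbf{y}_jh) : j\in[r], a\in\mathbf{y}_j, h\in G\}$. A hypergraph is simple if no hyperedge is a subset of another hyperedge. A cycle on $\mathbf{y}$ is a cyclic permutation $\tau=(a_1,\ldots,a_m)$ of all elements of $\mathbf{y}$; for $g\in G$, $\tau_g=(a_1g,\ldots,a_mg)$ on $\mathbf{y}g$; $\tau$ is ideal if $\tau_g=\tau$ for all $g$ with $\mathbf{y}g=\mathbf{y}$. Given a cyclic permutation $\rho_{[Y]}$ of all elements of $[Y]$ and ideal cycles $\tau_i$ on $\mathbf{y}_i$, with $\tau_{[r]}=\{\tau_i : i\in[r]\}$, the Cayley hypermap $\mathrm{CM}(G,Y,\rho_{[Y]},\tau_{[r]})$ is the oriented hypermap $(D;\rho,\tau)$ with $(g,\mathbf{x}g)^\rho=(g,\mathbf{x}^{\rho_{[Y]}}g)$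 and $(ah,\mathbf{y}_jh)^\tau=(a^{\tau_j}h,\mathbf{y}_jh)$ for $a\in\mathbf{y}_j$, $h\in G$. (For the $X$ of the claim, $[X]=X$ and the cycles $\tau_i$ are ideal.) An oriented hypermap $(D;\rho,\tau)$ is a finite set $D$ with permutations $\rho,\tau$ generating a transitive group on $D$; its automorphism group $\mathrm{Aut}(\mathcal{M})$ consists of the permutations of $D$ commuting with both $\rho$ and $\tau$; it is regular if $\langle\rho,\tau\rangle$ acts regularly on $D$. $G_R=\{h_R : h\in G\}$ acts on $D$ by $(g,\mathbf{x}g)^{h_R}=(gh,\mathbf{x}gh)$, and $\sigma$ acts on $D$ by $(g,\mathbf{x}g)^\sigma=(g^\sigma,\mathbf{x}^\sigma g^\sigma)$; in the claim $\langle\sigma\rangle$ and $G_R$ are regarded as permutation groups on $D$ in this way. *)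

theory Defs
  imports "HOL-Algebra.Algebra" "HOL-Combinatorics.Cycles"
begin

text \<open>
  In the source permutations act on the right, so that products of permutations are read from left
  to right, whereas the product \<open>f \<otimes> g\<close> of \<open>BijGroup\<close> applies \<open>g\<close> first. Accordingly
  \<open>a\<^sup>\<sigma>\<close> is rendered as \<open>\<sigma> a\<close>, and a product \<open>AB\<close> of two sets of permutations of \<open>D\<close> as
  \<open>B <#>\<^bsub>BijGroup D\<^esub> A\<close>.
\<close>

section \<open>Hypergraphs\<close>

record 'v hypergraph =
  vertices :: "'v set"
  hyperedges :: "'v set set"

definition simple_hypergraph :: "'v hypergraph \<Rightarrow> bool" where
  "simple_hypergraph \<Gamma> \<longleftrightarrow>
     (\<forall>e\<in>hyperedges \<Gamma>. \<forall>f\<in>hyperedges \<Gamma>. e \<noteq> f \<longrightarrow> \<not> e \<subseteq> f)"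

section \<open>Oriented hypermaps\<close>

record 'd hypermap =
  darts :: "'d set"
  rho :: "'d \<Rightarrow> 'd"
  tau :: "'d \<Rightarrow> 'd"

definition monodromy_group :: "'d hypermap \<Rightarrow> ('d \<Rightarrow> 'd) monoid" where
  "monodromy_group M = subgroup_generated (BijGroup (darts M)) {rho M, tau M}"

definition oriented_hypermap :: "'d hypermap \<Rightarrow> bool" where
  "oriented_hypermap M \<longleftrightarrow>
     finite (darts M) \<and> rho M \<in> Bij (darts M) \<and> tau M \<in> Bij (darts M) \<and>
     transitive_action (monodromy_group M) (darts M) (\<lambda>f. f)"

definition regular_hypermap :: "'d hypermap \<Rightarrow> bool" where
  "regular_hypermap M \<longleftrightarrow>
     oriented_hypermap M \<and>
     (\<forall>d\<in>darts M. stabilizer (monodromy_group M) (\<lambda>f. f) d = {\<one>\<^bsub>monodromy_group M\<^esub>})"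

definition hypermap_Aut :: "'d hypermap \<Rightarrow> ('d \<Rightarrow> 'd) set" where
  "hypermap_Aut M =
     {f \<in> Bij (darts M). \<forall>d\<in>darts M. f (rho M d) = rho M (f d) \<and> f (tau M d) = tau M (f d)}"

section \<open>Cayley equivalence and Cayley hypergraphs\<close>

definition cayley_equivalent ::
  "('a, 'b) monoid_scheme \<Rightarrow> 'a set \<Rightarrow> 'a set \<Rightarrow> bool" where
  "cayley_equivalent G x y \<longleftrightarrow> (\<exists>g\<in>x. x #>\<^bsub>G\<^esub> inv\<^bsub>G\<^esub> g = y)"

definition non_cayley_equivalent_hyperset ::
  "('a, 'b) monoid_scheme \<Rightarrow> 'a set set \<Rightarrow> bool" where
  "non_cayley_equivalent_hyperset G Y \<longleftrightarrow>
     (\<forall>y\<in>Y. y \<subseteq> carrier G \<and> \<one>\<^bsub>G\<^esub> \<in> y) \<and>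
     (\<forall>x\<in>Y. \<forall>y\<in>Y. x \<noteq> y \<longrightarrow> \<not> cayley_equivalent G x y)"

definition cayley_closure ::
  "('a, 'b) monoid_scheme \<Rightarrow> 'a set set \<Rightarrow> 'a set set" where
  "cayley_closure G Y = {y #>\<^bsub>G\<^esub> inv\<^bsub>G\<^esub> g | y g. y \<in> Y \<and> g \<in> y}"

definition cayley_hypergraph ::
  "('a, 'b) monoid_scheme \<Rightarrow> 'a set set \<Rightarrow> 'a hypergraph" where
  "cayley_hypergraph G Y =
     \<lparr>vertices = carrier G, hyperedges = {y #>\<^bsub>G\<^esub> g | y g. y \<in> Y \<and> g \<in> carrier G}\<rparr>"

definition cayley_arcs ::
  "('a, 'b) monoid_scheme \<Rightarrow> 'a set set \<Rightarrow> ('a \<times> 'a set) set" where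
  "cayley_arcs G Y = {(g, x #>\<^bsub>G\<^esub> g) | g x. g \<in> carrier G \<and> x \<in> cayley_closure G Y}"

section \<open>Cayley hypermaps\<close>

definition cyclic_permutation_of :: "'a set \<Rightarrow> ('a \<Rightarrow> 'a) \<Rightarrow> bool" where
  "cyclic_permutation_of S \<pi> \<longleftrightarrow> (\<exists>cs. cycle cs \<and> set cs = S \<and> \<pi> = cycle_of_list cs)"

definition ideal_cycle ::
  "('a, 'b) monoid_scheme \<Rightarrow> 'a set \<Rightarrow> ('a \<Rightarrow> 'a) \<Rightarrow> bool" where
  "ideal_cycle G y \<tau> \<longleftrightarrow>
     (\<exists>as. cycle as \<and> set as = y \<and> \<tau> = cycle_of_list as \<and>
        (\<forall>g\<in>carrier G. y #>\<^bsub>G\<^esub> g = y \<longrightarrow> cycle_of_list (map (\<lambda>a. a \<otimes>\<^bsub>G\<^esub> g) as) = \<tau>))"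

text \<open>
  The elements of the hyperset are enumerated without repetition as \<open>y 1, \<dots>, y r\<close>, and the
  cycle on \<open>y j\<close> is \<open>\<tau> j\<close>; values of \<open>y\<close> and \<open>\<tau>\<close> outside \<open>{1..r}\<close> are irrelevant.
\<close>

definition cayley_hypermap_data ::
  "('a, 'b) monoid_scheme \<Rightarrow> 'a set set \<Rightarrow> nat \<Rightarrow> (nat \<Rightarrow> 'a set) \<Rightarrow>
   ('a set \<Rightarrow> 'a set) \<Rightarrow> (nat \<Rightarrow> 'a \<Rightarrow> 'a) \<Rightarrow> bool" where
  "cayley_hypermap_data G Y r y \<rho> \<tau> \<longleftrightarrow>
     non_cayley_equivalent_hyperset G Y \<and> bij_betw y {1..r} Y \<and>
     cyclic_permutation_of (cayley_closure G Y) \<rho> \<and>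
     (\<forall>j\<in>{1..r}. ideal_cycle G (y j) (\<tau> j))"

text \<open>
  An arc may be of the form \<open>(ah, y\<^sub>jh)\<close> for several triples \<open>(a, j, h)\<close>, but under
  \<open>cayley_hypermap_data\<close> its image does not depend on the choice of the triple (this is what
  ideal cycles and Cayley inequivalence are for), so the descriptions below are proper.
\<close>

definition cayley_hypermap ::
  "('a, 'b) monoid_scheme \<Rightarrow> 'a set set \<Rightarrow> nat \<Rightarrow> (nat \<Rightarrow> 'a set) \<Rightarrow>
   ('a set \<Rightarrow> 'a set) \<Rightarrow> (nat \<Rightarrow> 'a \<Rightarrow> 'a) \<Rightarrow> ('a \<times> 'a set) hypermap" where
  "cayley_hypermap G Y r y \<rho> \<tau> =
     \<lparr>darts = cayley_arcs G Y,
      rho = (\<lambda>d\<in>cayley_arcs G Y. THE d'.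
        \<exists>g\<in>carrier G. \<exists>x\<in>cayley_closure G Y.
          d = (g, x #>\<^bsub>G\<^esub> g) \<and> d' = (g, \<rho> x #>\<^bsub>G\<^esub> g)),
      tau = (\<lambda>d\<in>cayley_arcs G Y. THE d'.
        \<exists>j\<in>{1..r}. \<exists>a\<in>y j. \<exists>h\<in>carrier G.
          d = (a \<otimes>\<^bsub>G\<^esub> h, y j #>\<^bsub>G\<^esub> h) \<and> d' = (\<tau> j a \<otimes>\<^bsub>G\<^esub> h, y j #>\<^bsub>G\<^esub> h))\<rparr>"

section \<open>Actions on arcs\<close>

definition right_mult_on_arcs ::
  "('a, 'b) monoid_scheme \<Rightarrow> ('a \<times> 'a set) set \<Rightarrow> 'a \<Rightarrow> 'a \<times> 'a set \<Rightarrow> 'a \<times> 'a set" where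
  "right_mult_on_arcs G D h = (\<lambda>(g, e)\<in>D. (g \<otimes>\<^bsub>G\<^esub> h, e #>\<^bsub>G\<^esub> h))"

text \<open>For an automorphism \<open>\<sigma>\<close> and \<open>e = xg\<close>, the image \<open>\<sigma> ` e\<close> is \<open>x\<^sup>\<sigma>g\<^sup>\<sigma>\<close>.\<close>

definition automorphism_on_arcs ::
  "('a \<times> 'a set) set \<Rightarrow> ('a \<Rightarrow> 'a) \<Rightarrow> 'a \<times> 'a set \<Rightarrow> 'a \<times> 'a set" where
  "automorphism_on_arcs D \<sigma> = (\<lambda>(g, e)\<in>D. (\<sigma> g, \<sigma> ` e))"

end

theory Submission
  imports Defs "HOL-Number_Theory.Cong"
begin

text \<open>
  Write \<open>b\<^sub>i = \<sigma>\<^sup>i(a)\<close> and \<open>H\<^sub>i = \<langle>b\<^sub>i\<rangle>\<close>, with indices modulo \<open>k\<close>. The hyperset consists of the \<open>k\<close>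
  distinct subgroups \<open>H\<^sub>i\<close>, and a subgroup \<open>H\<close> satisfies \<open>H g\<^sup>-\<^sup>1 = H\<close> for all \<open>g \<in> H\<close>. Hence no two
  of the \<open>H\<^sub>i\<close> are Cayley equivalent, the closure \<open>[X]\<close> is \<open>X\<close> itself, and an arc is determined by
  its vertex \<open>g\<close> and an index \<open>i\<close> modulo \<open>k\<close>: it is \<open>(g, H\<^sub>i g)\<close>, called \<open>arc i g\<close> below.
  The cycle \<open>\<tau>\<^sub>i\<close> is multiplication by \<open>b\<^sub>i\<close> on \<open>H\<^sub>i\<close>, so in these coordinates the hypermap becomes
  \<open>\<rho>: (g, i) \<mapsto> (g, i + 1)\<close> and \<open>\<tau>: (g, i) \<mapsto> (b\<^sub>i g, i)\<close> (lemmas \<open>rho_arc\<close> and \<open>tau_arc\<close>).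

  This makes everything visible. Since the \<open>b\<^sub>i\<close> generate \<open>G\<close>, every arc can be reached from
  \<open>(1, 0)\<close> (\<open>darts_connected\<close>). Right multiplication \<open>(g, i) \<mapsto> (g h, i)\<close> commutes with \<open>\<rho>\<close> and
  \<open>\<tau>\<close>, and so does \<open>\<sigma>\<close>, which acts by \<open>(g, i) \<mapsto> (g\<^sup>\<sigma>, i + 1)\<close>, because \<open>\<sigma>\<close> maps \<open>b\<^sub>i\<close> to
  \<open>b\<^sub>i\<^sub>+\<^sub>1\<close>. Together they move \<open>(1, 0)\<close> to every arc. A connected hypermap whose automorphisms
  act transitively on the arcs is regular, and an automorphism of it is determined by the image of
  one arc; so the products of powers of \<open>\<sigma>\<close> with right multiplications are all the automorphisms
  (\<open>regular_hypermapI\<close>). The hypergraph is simple because all hyperedges, being cosets of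
  subgroups that \<open>\<sigma>\<close> maps to one another, have the same finite cardinality.
\<close>

section \<open>Hypermaps with a transitive set of automorphisms\<close>

lemma BijGroup_mult_apply:
  assumes "f \<in> Bij D" "g \<in> Bij D" "d \<in> D"
  shows "(f \<otimes>\<^bsub>BijGroup D\<^esub> g) d = f (g d)"
  using assms by (simp add: BijGroup_def compose_def)

lemma BijGroup_inv_apply:
  assumes "f \<in> Bij D" "d \<in> D"
  shows "f ((inv\<^bsub>BijGroup D\<^esub> f) d) = d" "(inv\<^bsub>BijGroup D\<^esub> f) d \<in> D"
  using assms by (simp_all add: inv_BijGroup Bij_def bij_betw_inv_into_right bij_betw_def inv_into_into)

lemma Bij_inj_on: "f \<in> Bij D \<Longrightarrow> inj_on f D"
  by (simp add: Bij_def bij_betw_def)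

lemma Bij_closed: "f \<in> Bij D \<Longrightarrow> d \<in> D \<Longrightarrow> f d \<in> D"
  using Bij_imp_funcset by blast

lemma finite_inj_restrict_Bij:
  assumes "finite D" "inj_on f D" "\<And>d. d \<in> D \<Longrightarrow> f d \<in> D"
  shows "restrict f D \<in> Bij D"
proof -
  have "f ` D = D"
    using assms by (intro endo_inj_surj) auto
  then show ?thesis
    using assms(2) by (auto simp: Bij_def bij_betw_def inj_on_def)
qed

lemma hypermap_Aut_compose:
  assumes \<rho>: "rho M \<in> Bij (darts M)" and \<tau>: "tau M \<in> Bij (darts M)"
    and "f \<in> hypermap_Aut M" "g \<in> hypermap_Aut M"
  shows "f \<otimes>\<^bsub>BijGroup (darts M)\<^esub> g \<in> hypermap_Aut M"
proof -
  let ?D = "darts M"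
  let ?fg = "f \<otimes>\<^bsub>BijGroup ?D\<^esub> g"
  have f: "f \<in> Bij ?D" and g: "g \<in> Bij ?D"
    using assms by (auto simp: hypermap_Aut_def)
  then have fg: "?fg \<in> Bij ?D"
    by (simp add: BijGroup_def compose_Bij)
  have mult: "?fg d = f (g d)" if "d \<in> ?D" for d
    using f g that by (rule BijGroup_mult_apply)
  have "?fg (c d) = c (?fg d)" if "c = rho M \<or> c = tau M" "d \<in> ?D" for c d
    using that assms g \<rho> \<tau> by (auto simp: mult hypermap_Aut_def Bij_closed)
  then show ?thesis
    using fg by (simp add: hypermap_Aut_def)
qed

lemma monodromy_carrier_Bij:
  assumes "rho M \<in> Bij (darts M)" "tau M \<in> Bij (darts M)"
  shows "carrier (monodromy_group M) = generate (BijGroup (darts M)) {rho M, tau M}"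
    and "generate (BijGroup (darts M)) {rho M, tau M} \<subseteq> Bij (darts M)"
proof -
  interpret B: group "BijGroup (darts M)" by (rule group_BijGroup)
  have sub: "{rho M, tau M} \<subseteq> carrier (BijGroup (darts M))"
    using assms by (simp add: BijGroup_def)
  then show "carrier (monodromy_group M) = generate (BijGroup (darts M)) {rho M, tau M}"
    by (simp add: monodromy_group_def carrier_subgroup_generated Int_absorb1)
  show "generate (BijGroup (darts M)) {rho M, tau M} \<subseteq> Bij (darts M)"
    using B.generate_incl[OF sub] by (simp add: BijGroup_def)
qed

text \<open>
  An automorphism commutes with \<open>\<rho>\<close> and \<open>\<tau>\<close>, hence with their inverses and with all products.
\<close>

lemma automorphism_commutes_monodromy:
  assumes \<rho>: "rho M \<in> Bij (darts M)" and \<tau>: "tau M \<in> Bij (darts M)"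
    and f: "f \<in> hypermap_Aut M" and m: "m \<in> carrier (monodromy_group M)"
    and d: "d \<in> darts M"
  shows "f (m d) = m (f d)"
proof -
  let ?B = "BijGroup (darts M)"
  have fB: "f \<in> Bij (darts M)"
    and comm: "\<And>c d. c \<in> {rho M, tau M} \<Longrightarrow> d \<in> darts M \<Longrightarrow> f (c d) = c (f d)"
    using f by (auto simp: hypermap_Aut_def)
  have "m \<in> generate ?B {rho M, tau M}"
    using m monodromy_carrier_Bij(1)[OF \<rho> \<tau>] by simp
  then show ?thesis
    using d
  proof (induction arbitrary: d)
    case one
    then show ?case using fB by (simp add: BijGroup_def Bij_closed)
  next
    case (incl c)
    then show ?case by (rule comm)
  next
    case (inv c)
    have c: "c \<in> Bij (darts M)" using inv.hyps \<rho> \<tau> by auto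
    let ?e = "(inv\<^bsub>?B\<^esub> c) d"
    have "c (f ?e) = f (c ?e)"
      using comm inv BijGroup_inv_apply(2)[OF c] by simp
    also have "\<dots> = c ((inv\<^bsub>?B\<^esub> c) (f d))"
      using BijGroup_inv_apply(1)[OF c] inv.prems fB by (simp add: Bij_closed)
    finally show ?case
      using Bij_inj_on[OF c] BijGroup_inv_apply(2)[OF c] inv.prems fB
      by (meson Bij_closed inj_onD)
  next
    case (eng h1 h2)
    have "h1 \<in> Bij (darts M)" "h2 \<in> Bij (darts M)"
      using eng.hyps monodromy_carrier_Bij(2)[OF \<rho> \<tau>] by auto
    then show ?case
      using eng fB by (simp add: BijGroup_mult_apply Bij_closed)
  qed
qed

text \<open>
  Connectedness is expressed by closure under \<open>\<rho>\<close> and \<open>\<tau>\<close> alone, since this is what gets checked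
  in examples. It is used twice: for the orbit of \<open>d0\<close>, which gives transitivity of the monodromy
  group, and for the set where two automorphisms agree, which shows that an automorphism is
  determined by its value at \<open>d0\<close>, so that \<open>A\<close> already contains all of them. Dually, a monodromy
  element fixing one dart commutes with the transitive set \<open>A\<close> and therefore fixes every dart.
\<close>

lemma regular_hypermapI:
  fixes M :: "'d hypermap"
  assumes fin: "finite (darts M)"
    and \<rho>: "rho M \<in> Bij (darts M)" and \<tau>: "tau M \<in> Bij (darts M)"
    and d0: "d0 \<in> darts M"
    and connected: "\<And>R. d0 \<in> R \<Longrightarrow> R \<subseteq> darts M \<Longrightarrow> (\<And>d. d \<in> R \<Longrightarrow> rho M d \<in> R) \<Longrightarrow>
      (\<And>d. d \<in> R \<Longrightarrow> tau M d \<in> R) \<Longrightarrow> R = darts M"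
    and A: "A \<subseteq> hypermap_Aut M" and A_trans: "\<And>d. d \<in> darts M \<Longrightarrow> \<exists>f\<in>A. f d0 = d"
  shows "regular_hypermap M" and "hypermap_Aut M = A"
proof -
  let ?D = "darts M" and ?B = "BijGroup (darts M)" and ?N = "monodromy_group M"
  interpret B: group ?B by (rule group_BijGroup)
  note N_carrier = monodromy_carrier_Bij(1)[OF \<rho> \<tau>]
  have N_Bij: "m \<in> Bij ?D" if "m \<in> carrier ?N" for m
    using that monodromy_carrier_Bij[OF \<rho> \<tau>] by auto
  have N_mult: "m \<otimes>\<^bsub>?N\<^esub> n = m \<otimes>\<^bsub>?B\<^esub> n" for m n
    by (simp add: monodromy_group_def)
  interpret N: group ?N
    unfolding monodromy_group_def by (rule B.group_subgroup_generated)
  have "(\<lambda>f. f) \<in> hom ?N ?B"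
    using N_Bij by (intro homI) (auto simp: N_mult BijGroup_def)
  with N.is_group B.is_group have action: "group_action ?N ?D (\<lambda>f. f)"
    by (auto simp: group_action_def group_hom_def group_hom_axioms_def)
  have N_apply: "(m \<otimes>\<^bsub>?N\<^esub> n) d = m (n d)"
    if "m \<in> carrier ?N" "n \<in> carrier ?N" "d \<in> ?D" for m n d
    using that N_Bij by (simp add: N_mult BijGroup_mult_apply)
  have orbit: "{m d0 |m. m \<in> carrier ?N} = ?D"
  proof (rule connected)
    show "d0 \<in> {m d0 |m. m \<in> carrier ?N}"
    proof (intro CollectI exI conjI)
      show "d0 = \<one>\<^bsub>?N\<^esub> d0"
        using d0 by (simp add: monodromy_group_def BijGroup_def)
    qed (rule N.one_closed)
    show "{m d0 |m. m \<in> carrier ?N} \<subseteq> ?D"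
      using N_Bij d0 by (auto simp: Bij_closed)
    have closed: "c d \<in> {m d0 |m. m \<in> carrier ?N}"
      if c: "c \<in> {rho M, tau M}" and d: "d \<in> {m d0 |m. m \<in> carrier ?N}" for c d
    proof -
      have cN: "c \<in> carrier ?N"
        using c generate.incl unfolding N_carrier by metis
      obtain m where "m \<in> carrier ?N" "d = m d0" using d by auto
      with cN show ?thesis
        using N_apply[OF cN _ d0] N.m_closed[OF cN] by (metis (mono_tags, lifting) mem_Collect_eq)
    qed
    show "\<And>d. d \<in> {m d0 |m. m \<in> carrier ?N} \<Longrightarrow> rho M d \<in> {m d0 |m. m \<in> carrier ?N}"
      "\<And>d. d \<in> {m d0 |m. m \<in> carrier ?N} \<Longrightarrow> tau M d \<in> {m d0 |m. m \<in> carrier ?N}"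
      using closed by blast+
  qed
  have "transitive_action ?N ?D (\<lambda>f. f)"
  proof (intro transitive_action.intro action transitive_action_axioms.intro)
    fix x z assume x: "x \<in> ?D" and z: "z \<in> ?D"
    obtain m n where m: "m \<in> carrier ?N" "x = m d0" and n: "n \<in> carrier ?N" "z = n d0"
      using orbit x z by blast
    have "(n \<otimes>\<^bsub>?N\<^esub> inv\<^bsub>?N\<^esub> m) (m d0) = (n \<otimes>\<^bsub>?N\<^esub> inv\<^bsub>?N\<^esub> m \<otimes>\<^bsub>?N\<^esub> m) d0"
      using m n d0 by (simp add: N_apply)
    also have "\<dots> = n d0"
      using m n by (simp add: N.m_assoc)
    finally show "\<exists>g\<in>carrier ?N. g x = z"
      using m n by (intro bexI[of _ "n \<otimes>\<^bsub>?N\<^esub> inv\<^bsub>?N\<^esub> m"]) auto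
  qed
  then have oriented: "oriented_hypermap M"
    using fin \<rho> \<tau> by (simp add: oriented_hypermap_def)
  moreover have "stabilizer ?N (\<lambda>f. f) d = {\<one>\<^bsub>?N\<^esub>}" if d: "d \<in> ?D" for d
  proof -
    have "m = \<one>\<^bsub>?N\<^esub>" if m: "m \<in> carrier ?N" and md: "m d = d" for m
    proof -
      obtain f where f: "f \<in> A" "f d0 = d" using A_trans d by blast
      then have fAut: "f \<in> hypermap_Aut M" using A by auto
      have "f (m d0) = f d0"
        using automorphism_commutes_monodromy[OF \<rho> \<tau> fAut m d0] f md by simp
      moreover have "inj_on f ?D"
        using fAut by (simp add: hypermap_Aut_def Bij_inj_on)
      ultimately have m0: "m d0 = d0"
        using d0 m N_Bij by (meson Bij_closed inj_onD)
      have "m e = e" if e: "e \<in> ?D" for e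
      proof -
        obtain g where g: "g \<in> A" "g d0 = e" using A_trans e by blast
        then have gAut: "g \<in> hypermap_Aut M" using A by auto
        show ?thesis
          using automorphism_commutes_monodromy[OF \<rho> \<tau> gAut m d0] g m0 by simp
      qed
      then have "m = (\<lambda>x\<in>?D. x)"
        using N_Bij[OF m] by (intro extensionalityI[of m ?D]) (auto simp: Bij_def)
      then show ?thesis by (simp add: monodromy_group_def BijGroup_def)
    qed
    moreover have "\<one>\<^bsub>?N\<^esub> d = d"
      using d by (simp add: monodromy_group_def BijGroup_def)
    ultimately show ?thesis by (auto simp: stabilizer_def)
  qed
  ultimately show "regular_hypermap M" by (simp add: regular_hypermap_def)
  have "f \<in> A" if f: "f \<in> hypermap_Aut M" for f
  proof -
    have fB: "f \<in> Bij ?D" using f by (simp add: hypermap_Aut_def)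
    obtain g where g: "g \<in> A" "g d0 = f d0"
      using A_trans[of "f d0"] fB d0 by (auto simp: Bij_closed)
    have gAut: "g \<in> hypermap_Aut M" using g A by auto
    have "{d \<in> ?D. f d = g d} = ?D"
    proof (rule connected)
      show "\<And>d. d \<in> {d \<in> ?D. f d = g d} \<Longrightarrow> rho M d \<in> {d \<in> ?D. f d = g d}"
        "\<And>d. d \<in> {d \<in> ?D. f d = g d} \<Longrightarrow> tau M d \<in> {d \<in> ?D. f d = g d}"
        using f gAut \<rho> \<tau> by (auto simp: hypermap_Aut_def Bij_closed)
    qed (use g d0 in auto)
    then have "f = g"
      using fB gAut by (intro extensionalityI[of f ?D]) (auto simp: hypermap_Aut_def Bij_def)
    then show ?thesis using g by simp
  qed
  then show "hypermap_Aut M = A" using A by auto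
qed

section \<open>Cycles given by lists\<close>

lemma cycle_of_list_nth:
  assumes "cycle cs" "i < length cs"
  shows "cycle_of_list cs (cs ! i) = cs ! (Suc i mod length cs)"
proof -
  have "map (cycle_of_list cs) cs ! i = rotate1 cs ! i"
    using cyclic_rotation[OF assms(1), of 1] by simp
  then show ?thesis
    using assms(2) by (simp add: nth_rotate1)
qed

lemma (in group) nat_pow_mod_ord:
  assumes "x \<in> carrier G"
  shows "x [^] (n mod ord x) = x [^] n"
proof -
  have "x [^] n = x [^] (ord x * (n div ord x) + n mod ord x)"
    by simp
  also have "\<dots> = (x [^] ord x) [^] (n div ord x) \<otimes> x [^] (n mod ord x)"
    using assms by (simp only: nat_pow_pow nat_pow_mult nat_pow_closed)
  also have "\<dots> = x [^] (n mod ord x)"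
    using assms by (simp add: pow_ord_eq_1)
  finally show ?thesis by simp
qed

section \<open>The orbit of a cyclic subgroup\<close>

text \<open>
  Positivity of \<open>k\<close> says that \<open>\<sigma>\<close> has finite order, the order of an element of infinite order
  being \<open>0\<close> by convention. All families below are indexed by \<open>nat\<close> and periodic with period \<open>k\<close>,
  which avoids case distinctions at the end of the cycle \<open>\<rho>\<close>.
\<close>

locale cyclic_subgroup_orbit = group G for G :: "('a, 'b) monoid_scheme" (structure) +
  fixes \<sigma> :: "'a \<Rightarrow> 'a" and a :: 'a and k :: nat
  assumes finite_carrier: "finite (carrier G)"
    and \<sigma>: "\<sigma> \<in> auto G" and ord_\<sigma>: "group.ord (AutoGroup G) \<sigma> = k" and k_pos: "0 < k"
    and a: "a \<in> carrier G"
    and distinct_subgroups: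
      "\<And>i. i \<in> {1..k - 1} \<Longrightarrow> generate G {a} \<noteq> generate G {(\<sigma> [^]\<^bsub>AutoGroup G\<^esub> i) a}"
    and generates: "generate G (range (\<lambda>i::nat. (\<sigma> [^]\<^bsub>AutoGroup G\<^esub> i) a)) = carrier G"
begin

definition \<phi> :: "nat \<Rightarrow> 'a \<Rightarrow> 'a" where "\<phi> i = \<sigma> [^]\<^bsub>AutoGroup G\<^esub> i"

definition b :: "nat \<Rightarrow> 'a" where "b i = \<phi> i a"

definition H :: "nat \<Rightarrow> 'a set" where "H i = generate G {b i}"

definition \<rho> :: "'a set \<Rightarrow> 'a set" where "\<rho> = cycle_of_list (map H [1..<k + 1])"

definition \<tau> :: "nat \<Rightarrow> 'a \<Rightarrow> 'a" where
  "\<tau> i = cycle_of_list (map (\<lambda>n. \<phi> i (a [^] n)) [0..<ord a])"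

definition M :: "('a \<times> 'a set) hypermap" where "M = cayley_hypermap G (range H) k H \<rho> \<tau>"

definition arc :: "nat \<Rightarrow> 'a \<Rightarrow> 'a \<times> 'a set" where "arc i g = (g, H i #> g)"

lemma \<phi>_auto: "\<phi> i \<in> auto G"
proof -
  interpret A: group "AutoGroup G" by (rule AutoGroup)
  show ?thesis
    using A.nat_pow_closed[of \<sigma> i] \<sigma> by (simp add: \<phi>_def AutoGroup_def)
qed

lemma \<phi>_hom: "group_hom G G (\<phi> i)"
  using \<phi>_auto[of i] is_group by (simp add: auto_def group_hom_def group_hom_axioms_def)

lemma \<phi>_closed [simp]: "g \<in> carrier G \<Longrightarrow> \<phi> i g \<in> carrier G"
  using \<phi>_hom by (rule group_hom.hom_closed)

lemma \<phi>_mult: "g \<in> carrier G \<Longrightarrow> h \<in> carrier G \<Longrightarrow> \<phi> i (g \<otimes> h) = \<phi> i g \<otimes> \<phi> i h"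
  using \<phi>_hom by (rule group_hom.hom_mult)

lemma \<phi>_inj: "inj_on (\<phi> i) (carrier G)"
  using \<phi>_auto[of i] by (simp add: auto_def Bij_inj_on)

lemma \<phi>_add: "g \<in> carrier G \<Longrightarrow> \<phi> (i + j) g = \<phi> i (\<phi> j g)"
proof -
  assume g: "g \<in> carrier G"
  interpret A: group "AutoGroup G" by (rule AutoGroup)
  have "\<phi> (i + j) = \<phi> i \<otimes>\<^bsub>AutoGroup G\<^esub> \<phi> j"
    unfolding \<phi>_def using A.nat_pow_mult[of \<sigma> i j] \<sigma> by (simp add: AutoGroup_def)
  then show ?thesis
    using \<phi>_auto[of i] \<phi>_auto[of j] g
    by (simp add: AutoGroup_def BijGroup_def auto_def compose_def)
qed

lemma \<phi>_0: "g \<in> carrier G \<Longrightarrow> \<phi> 0 g = g"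
  by (simp add: \<phi>_def AutoGroup_def BijGroup_def)

lemma \<phi>_mod: "\<phi> (i mod k) = \<phi> i"
proof -
  interpret A: group "AutoGroup G" by (rule AutoGroup)
  have \<sigma>A: "\<sigma> \<in> carrier (AutoGroup G)" using \<sigma> by (simp add: AutoGroup_def)
  show ?thesis
    unfolding \<phi>_def ord_\<sigma>[symmetric] by (rule A.nat_pow_mod_ord[OF \<sigma>A])
qed

lemma b_closed [simp]: "b i \<in> carrier G"
  by (simp add: b_def a)

lemma b_add: "\<phi> i (b j) = b (i + j)"
  by (simp add: b_def \<phi>_add a)

lemma H_subgroup: "subgroup (H i) G"
  by (simp add: H_def generate_is_subgroup)

lemma H_subset: "H i \<subseteq> carrier G"
  using H_subgroup by (rule subgroup.subset)

lemma H_powers: "H i = range (\<lambda>n::nat. b i [^] n)"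
  by (auto simp: H_def generate_pow_on_finite_carrier finite_carrier)

lemma \<phi>_image_H: "\<phi> i ` H j = H (i + j)"
  using group_hom.generate_img[OF \<phi>_hom, of "{b j}"] by (simp add: H_def b_add)

lemma H_mod: "H (i mod k) = H i"
  by (simp add: H_def b_def \<phi>_mod)

text \<open>
  The hypothesis only separates \<open>H 0\<close> from the other subgroups; applying a power of \<open>\<sigma>\<close> reduces
  any coincidence \<open>H i = H j\<close> to one that involves \<open>H 0\<close>.
\<close>

lemma H_eq_iff: "H i = H j \<longleftrightarrow> i mod k = j mod k"
proof
  assume eq: "H i = H j"
  show "i mod k = j mod k"
  proof (rule ccontr)
    assume ne: "i mod k \<noteq> j mod k"
    \<comment> \<open>Shifting both indices by \<open>c\<close> moves \<open>i\<close> to \<open>0\<close> modulo \<open>k\<close>.\<close>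
    define c where "c = k - i mod k"
    define e where "e = (c + j) mod k"
    have lt: "i mod k < k" using k_pos by simp
    have "(c + i) mod k = (c + i mod k) mod k" by presburger
    also have "\<dots> = 0" using lt by (simp add: c_def)
    finally have ci: "(c + i) mod k = 0" .
    have "e \<noteq> 0"
      using ne ci cong_add_lcancel_nat[of c i j k] by (auto simp: cong_def e_def)
    then have e: "e \<in> {1..k - 1}" using k_pos by (auto simp: e_def Suc_leI less_Suc_eq_le[symmetric])
    have "H 0 = H (c + i)" using H_mod[of "c + i"] ci by simp
    also have "\<dots> = H (c + j)" using \<phi>_image_H[of c i] \<phi>_image_H[of c j] eq by simp
    also have "\<dots> = H e" by (simp add: e_def H_mod)
    finally show False
      using distinct_subgroups[OF e] by (simp add: H_def b_def \<phi>_0 a) (simp add: \<phi>_def)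
  qed
next
  assume "i mod k = j mod k"
  then show "H i = H j" by (metis H_mod)
qed

text \<open>
  A cyclic subgroup may have several generators, but the chosen generator is a function of the
  subgroup. This makes the permutation \<open>\<tau>\<close> of the arcs well defined.
\<close>

lemma b_eq_if_H_eq: "H i = H j \<Longrightarrow> b i = b j"
proof -
  assume "H i = H j"
  then have "\<phi> (i mod k) = \<phi> (j mod k)" by (simp add: H_eq_iff)
  then show "b i = b j" by (simp add: b_def \<phi>_mod)
qed

lemma range_H: "range H = H ` {1..k}"
proof -
  have "H i \<in> H ` {1..k}" for i
  proof (cases "i mod k = 0")
    case True
    then have "H i = H k" by (simp add: H_eq_iff)
    then show ?thesis using k_pos by auto
  next
    case False
    have "H i = H (i mod k)" by (simp add: H_mod)
    moreover have "i mod k \<in> {1..k}"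
      using False k_pos by (auto simp: Suc_leI intro: less_imp_le)
    ultimately show ?thesis by blast
  qed
  then show ?thesis by auto
qed

lemma inj_on_H: "inj_on H {1..k}"
proof (rule inj_onI)
  fix i j assume ij: "i \<in> {1..k}" "j \<in> {1..k}" and "H i = H j"
  then have "i mod k = j mod k" by (simp add: H_eq_iff)
  then show "i = j" using ij
    by (cases "i = k"; cases "j = k") auto
qed

lemma bij_betw_H: "bij_betw H {1..k} (range H)"
  using inj_on_H range_H by (simp add: bij_betw_def)

lemma one_in_H: "\<one> \<in> H i"
  using H_subgroup by (rule subgroup.one_closed)

lemma coset_inv_H:
  assumes "g \<in> H i" shows "H i #> inv g = H i"
  using assms H_subgroup[of i] H_subset[of i]
  by (intro coset_join2) (auto simp: subgroup.m_inv_closed)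

lemma closure_subgroups: "cayley_closure G (range H) = range H"
proof -
  have "H i \<in> cayley_closure G (range H)" for i
    using coset_inv_H[OF one_in_H, of i] one_in_H[of i] unfolding cayley_closure_def by blast
  then show ?thesis by (auto simp: cayley_closure_def coset_inv_H)
qed

lemma distinct_H_list: "cycle (map H [1..<k + 1])"
  using inj_on_H by (simp add: distinct_map atLeastLessThanSuc_atLeastAtMost del: upt_Suc)

lemma set_H_list: "set (map H [1..<k + 1]) = range H"
  by (simp add: range_H atLeastLessThanSuc_atLeastAtMost del: upt_Suc)

lemma \<rho>_H: "\<rho> (H i) = H (Suc i)"
proof -
  have nth: "map H [1..<k + 1] ! n = H (Suc n)" if "n < k" for n
    using that by (simp add: nth_map del: upt_Suc)
  \<comment> \<open>The list starts with \<open>H 1\<close>, so \<open>H i\<close> stands in position \<open>i - 1\<close> modulo \<open>k\<close>; adding \<open>k\<close>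
    keeps the subtraction from truncating when \<open>i = 0\<close>.\<close>
  define n where "n = (i + k - 1) mod k"
  have n: "n < k" using k_pos by (simp add: n_def)
  have "Suc n mod k = i mod k"
    using k_pos by (simp add: n_def mod_Suc_eq)
  then have Hn: "H (Suc n) = H i" by (simp add: H_eq_iff)
  have "\<rho> (map H [1..<k + 1] ! n) = map H [1..<k + 1] ! (Suc n mod k)"
    unfolding \<rho>_def using cycle_of_list_nth[OF distinct_H_list, of n] n by simp
  then have "\<rho> (H i) = H (Suc (Suc n mod k))"
    using nth n k_pos Hn by simp
  also have "\<dots> = H (Suc i)"
    using \<open>Suc n mod k = i mod k\<close> by (simp add: H_eq_iff mod_Suc_eq)
  finally show ?thesis .
qed

lemma \<phi>_pow: "\<phi> i (a [^] n) = b i [^] (n::nat)"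
  by (simp add: b_def group_hom.hom_nat_pow[OF \<phi>_hom] a)

lemma card_H: "card (H i) = ord a"
proof -
  have "H i = \<phi> i ` H 0" using \<phi>_image_H[of i 0] by simp
  then have "card (H i) = card (H 0)"
    using card_image[OF inj_on_subset[OF \<phi>_inj H_subset]] by metis
  then show ?thesis
    by (simp add: H_def b_def \<phi>_0 a generate_pow_card)
qed

lemma ord_b: "ord (b i) = ord a"
  using card_H[of i] generate_pow_card[of "b i"] by (simp add: H_def)

lemma ord_a_pos: "0 < ord a"
  using ord_ge_1[OF finite_carrier a] by simp

abbreviation powers :: "nat \<Rightarrow> 'a list" where
  "powers i \<equiv> map (\<lambda>n. \<phi> i (a [^] n)) [0..<ord a]"

lemma nth_powers: "n < ord a \<Longrightarrow> powers i ! n = b i [^] n"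
  by (simp add: \<phi>_pow)

lemma distinct_powers: "cycle (powers i)"
proof -
  have "inj_on (\<lambda>n. b i [^] n) {0..ord a - 1}"
    using ord_inj[OF b_closed, of i] by (simp add: ord_b)
  moreover have "{0..<ord a} = {0..ord a - 1}" using ord_a_pos by auto
  ultimately show ?thesis by (simp add: distinct_map \<phi>_pow)
qed

lemma b_pow_mod: "b i [^] (n mod ord a) = b i [^] n"
  using nat_pow_mod_ord[OF b_closed, of i n] by (simp add: ord_b)

lemma set_powers: "set (powers i) = H i"
proof -
  have "b i [^] n \<in> (\<lambda>n. b i [^] n) ` {0..<ord a}" for n :: nat
    using b_pow_mod[of i n] ord_a_pos by (metis atLeastLessThan_iff image_eqI le0 mod_less_divisor)
  then show ?thesis by (auto simp: H_powers \<phi>_pow)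
qed

lemma \<tau>_mult:
  assumes "c \<in> H i" shows "\<tau> i c = b i \<otimes> c"
proof -
  obtain m :: nat where c: "c = b i [^] m" using assms by (auto simp: H_powers)
  define n where "n = m mod ord a"
  have n: "n < ord a" and cn: "c = b i [^] n"
    using ord_a_pos by (auto simp: n_def c b_pow_mod)
  have "\<tau> i (powers i ! n) = powers i ! (Suc n mod ord a)"
    unfolding \<tau>_def using cycle_of_list_nth[OF distinct_powers, of n i] n by simp
  then have "\<tau> i c = b i [^] (Suc n mod ord a)"
    using nth_powers n cn ord_a_pos by simp
  also have "\<dots> = b i \<otimes> c"
    unfolding b_pow_mod cn by (rule nat_pow_Suc2[OF b_closed])
  finally show ?thesis .
qed

text \<open>
  If \<open>H i #> g = H i\<close> then \<open>g\<close> is a power of \<open>b i\<close>, and multiplying the list of powers of \<open>b i\<close> by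
  \<open>g\<close> only rotates it.
\<close>

lemma ideal_\<tau>: "ideal_cycle G (H i) (\<tau> i)"
proof -
  have "cycle_of_list (map (\<lambda>c. c \<otimes> g) (powers i)) = \<tau> i"
    if g: "g \<in> carrier G" and eq: "H i #> g = H i" for g
  proof -
    have "g \<in> H i" using rcos_self[OF g H_subgroup] eq by blast
    then obtain m :: nat where m: "g = b i [^] m" by (auto simp: H_powers)
    have "map (\<lambda>c. c \<otimes> g) (powers i) = rotate m (powers i)"
    proof (rule nth_equalityI)
      fix n assume "n < length (map (\<lambda>c. c \<otimes> g) (powers i))"
      then have n: "n < ord a" by simp
      then have "map (\<lambda>c. c \<otimes> g) (powers i) ! n = b i [^] n \<otimes> b i [^] m"
        by (simp add: m \<phi>_pow)
      also have "\<dots> = b i [^] (m + n)"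
        by (simp only: nat_pow_mult[OF b_closed] add.commute)
      also have "\<dots> = powers i ! ((m + n) mod ord a)"
        using nth_powers[of "(m + n) mod ord a" i] ord_a_pos by (simp add: b_pow_mod)
      also have "\<dots> = rotate m (powers i) ! n"
        using nth_rotate[of n "powers i" m] n by simp
      finally show "map (\<lambda>c. c \<otimes> g) (powers i) ! n = rotate m (powers i) ! n" .
    qed simp
    then show ?thesis
      using cycle_of_list_rotate_independent[OF distinct_powers] by (simp add: \<tau>_def)
  qed
  then show ?thesis
    unfolding ideal_cycle_def using distinct_powers set_powers
    by (intro exI[of _ "powers i"]) (auto simp: \<tau>_def)
qed

lemma hypermap_data: "cayley_hypermap_data G (range H) k H \<rho> \<tau>"
proof -
  have "x = z" if x: "x \<in> range H" and xz: "cayley_equivalent G x z" for x z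
  proof -
    obtain g where g: "g \<in> x" and z: "x #> inv g = z"
      using xz unfolding cayley_equivalent_def by blast
    obtain i where i: "x = H i" using x by blast
    show ?thesis using coset_inv_H[of g i] g z i by simp
  qed
  then have "non_cayley_equivalent_hyperset G (range H)"
    using H_subset one_in_H unfolding non_cayley_equivalent_hyperset_def by blast
  moreover have "cyclic_permutation_of (cayley_closure G (range H)) \<rho>"
    unfolding closure_subgroups cyclic_permutation_of_def \<rho>_def
    using distinct_H_list set_H_list by blast
  ultimately show ?thesis
    using bij_betw_H ideal_\<tau> by (simp add: cayley_hypermap_data_def)
qed

text \<open>All hyperedges have \<open>ord a\<close> elements, so containment forces equality.\<close>

lemma simple: "simple_hypergraph (cayley_hypergraph G (range H))"
proof -
  have card: "card (H i #> g) = ord a" if "g \<in> carrier G" for i g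
    using card_rcosets_equal[OF rcosetsI[OF H_subset that] H_subset] card_H by metis
  have fin: "finite (H i #> g)" if "g \<in> carrier G" for i g
    using finite_subset[OF r_coset_subset_G[OF H_subset that] finite_carrier] .
  show ?thesis
    using card fin by (auto simp: simple_hypergraph_def cayley_hypergraph_def) (metis card_subset_eq)+
qed

section \<open>The arcs of the hypermap\<close>

lemma darts_eq: "darts M = {arc i g |i g. g \<in> carrier G}"
proof -
  have "darts M = {(g, x #> g) |g x. g \<in> carrier G \<and> x \<in> range H}"
    unfolding M_def cayley_hypermap_def cayley_arcs_def closure_subgroups by (simp only: hypermap.simps)
  also have "\<dots> = {arc i g |i g. g \<in> carrier G}"
    unfolding arc_def by blast
  finally show ?thesis .
qed

lemma finite_darts: "finite (darts M)"
proof -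
  have "darts M \<subseteq> carrier G \<times> Pow (carrier G)"
    using r_coset_subset_G[OF H_subset] by (auto simp: darts_eq arc_def)
  then show ?thesis
    using finite_carrier by (meson finite_Pow_iff finite_SigmaI finite_subset)
qed

lemma arc_in_darts [simp]: "g \<in> carrier G \<Longrightarrow> arc i g \<in> darts M"
  unfolding darts_eq by blast

lemma dartsE:
  assumes "d \<in> darts M"
  obtains i g where "g \<in> carrier G" "d = arc i g"
  using assms unfolding darts_eq by blast

lemma coset_inj:
  assumes g: "g \<in> carrier G" and eq: "H i #> g = H j #> g"
  shows "H i = H j"
proof -
  have "H n = (H n #> g) #> inv g" for n
    using g H_subset by (simp add: coset_mult_assoc coset_mult_one)
  then show ?thesis using eq by metis
qed

lemma arc_eq_iff:
  assumes "g \<in> carrier G"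
  shows "arc i g = arc j h \<longleftrightarrow> g = h \<and> i mod k = j mod k"
proof -
  have "H i #> g = H j #> g \<longleftrightarrow> H i = H j"
    using coset_inj[OF assms] by metis
  then show ?thesis
    by (auto simp: arc_def H_eq_iff)
qed

lemma rho_arc:
  assumes g: "g \<in> carrier G"
  shows "rho M (arc i g) = arc (Suc i) g"
proof -
  have "rho M (arc i g) = (THE d'. \<exists>h\<in>carrier G. \<exists>x\<in>range H.
      arc i g = (h, x #> h) \<and> d' = (h, \<rho> x #> h))"
    using arc_in_darts[OF g, of i] unfolding M_def cayley_hypermap_def closure_subgroups by simp
  also have "\<dots> = arc (Suc i) g"
  proof (rule the_equality)
    show "\<exists>h\<in>carrier G. \<exists>x\<in>range H. arc i g = (h, x #> h) \<and> arc (Suc i) g = (h, \<rho> x #> h)"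
      using g by (intro bexI[of _ g] bexI[of _ "H i"]) (auto simp: arc_def \<rho>_H)
  next
    fix d' assume "\<exists>h\<in>carrier G. \<exists>x\<in>range H. arc i g = (h, x #> h) \<and> d' = (h, \<rho> x #> h)"
    then obtain j where "H i #> g = H j #> g" "d' = (g, \<rho> (H j) #> g)"
      by (auto simp: arc_def)
    then show "d' = arc (Suc i) g"
      using coset_inj[OF g] \<rho>_H by (metis arc_def)
  qed
  finally show ?thesis .
qed

text \<open>
  A triple \<open>(j, c, h)\<close> describing \<open>arc i g\<close> satisfies \<open>c \<otimes> h = g\<close> and \<open>H j = H i\<close>. Its image has
  the vertex \<open>\<tau> j c \<otimes> h = b j \<otimes> c \<otimes> h = b i \<otimes> g\<close>, whatever the triple.
\<close>

lemma tau_arc: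
  assumes g: "g \<in> carrier G"
  shows "tau M (arc i g) = arc i (b i \<otimes> g)"
proof -
  have step: "H i #> (b i \<otimes> g) = H i #> g" for i
    using repr_independence[OF rcosI[OF _ H_subset g, of "b i"] g H_subgroup]
    by (simp add: H_def generate.incl)
  have "tau M (arc i g) = (THE d'. \<exists>j\<in>{1..k}. \<exists>c\<in>H j. \<exists>h\<in>carrier G.
      arc i g = (c \<otimes> h, H j #> h) \<and> d' = (\<tau> j c \<otimes> h, H j #> h))"
    using arc_in_darts[OF g, of i] unfolding M_def cayley_hypermap_def by simp
  also have "\<dots> = arc i (b i \<otimes> g)"
  proof (rule the_equality)
    obtain j where j: "j \<in> {1..k}" "H j = H i" using range_H by (metis imageE rangeI)
    have one: "\<one> \<in> H j" by (rule one_in_H)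
    have "arc i g = (\<one> \<otimes> g, H j #> g) \<and> arc i (b i \<otimes> g) = (\<tau> j \<one> \<otimes> g, H j #> g)"
      using g \<tau>_mult[OF one] j step[of i] b_eq_if_H_eq[OF j(2)] by (simp add: arc_def)
    then show "\<exists>j\<in>{1..k}. \<exists>c\<in>H j. \<exists>h\<in>carrier G.
      arc i g = (c \<otimes> h, H j #> h) \<and> arc i (b i \<otimes> g) = (\<tau> j c \<otimes> h, H j #> h)"
      using j one g by blast
  next
    fix d' assume "\<exists>j\<in>{1..k}. \<exists>c\<in>H j. \<exists>h\<in>carrier G.
      arc i g = (c \<otimes> h, H j #> h) \<and> d' = (\<tau> j c \<otimes> h, H j #> h)"
    then obtain j c h where c: "c \<in> H j" and h: "h \<in> carrier G" and gc: "g = c \<otimes> h"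
      and eq: "H i #> g = H j #> h" and d': "d' = (\<tau> j c \<otimes> h, H j #> h)"
      by (auto simp: arc_def)
    have cG: "c \<in> carrier G" using c H_subset by auto
    have "H j #> h = H j #> g"
      using repr_independence[OF rcosI[OF c H_subset h] h H_subgroup] gc by simp
    then have "H i = H j" using coset_inj[OF g] eq by simp
    moreover have "\<tau> j c \<otimes> h = b j \<otimes> g"
      using \<tau>_mult[OF c] gc cG h by (simp add: m_assoc)
    ultimately show "d' = arc i (b i \<otimes> g)"
      using d' eq step[of i] b_eq_if_H_eq[of i j] by (simp add: arc_def)
  qed
  finally show ?thesis .
qed

lemma Bij_dartsI:
  assumes "f \<in> extensional (darts M)"
    and "\<And>i g. g \<in> carrier G \<Longrightarrow> f (arc i g) \<in> darts M"
    and "\<And>i g j h. g \<in> carrier G \<Longrightarrow> h \<in> carrier G \<Longrightarrow> f (arc i g) = f (arc j h) \<Longrightarrow>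
      g = h \<and> i mod k = j mod k"
  shows "f \<in> Bij (darts M)"
proof -
  have "inj_on f (darts M)"
  proof (rule inj_onI)
    fix c d assume c: "c \<in> darts M" and d: "d \<in> darts M" and eq: "f c = f d"
    obtain i g where g: "g \<in> carrier G" "c = arc i g" using c by (rule dartsE)
    obtain j h where h: "h \<in> carrier G" "d = arc j h" using d by (rule dartsE)
    show "c = d" using assms(3)[of g h i j] g h eq by (simp add: arc_eq_iff)
  qed
  then have "restrict f (darts M) \<in> Bij (darts M)"
    using assms(2) by (intro finite_inj_restrict_Bij[OF finite_darts]) (auto elim!: dartsE)
  then show ?thesis using extensional_restrict[OF assms(1)] by simp
qed

lemma rho_Bij: "rho M \<in> Bij (darts M)"
proof (rule Bij_dartsI)
  show "rho M \<in> extensional (darts M)"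
    unfolding M_def cayley_hypermap_def by (simp only: hypermap.simps restrict_extensional)
next
  fix i g j h
  assume g: "g \<in> carrier G" and h: "h \<in> carrier G" and "rho M (arc i g) = rho M (arc j h)"
  then have "arc (i + 1) g = arc (j + 1) h" by (simp add: rho_arc)
  then have "g = h \<and> (i + 1) mod k = (j + 1) mod k" by (simp only: arc_eq_iff[OF g])
  then show "g = h \<and> i mod k = j mod k"
    using cong_add_rcancel_nat[of i 1 j k] by (simp add: cong_def)
qed (simp add: rho_arc)

lemma tau_Bij: "tau M \<in> Bij (darts M)"
proof (rule Bij_dartsI)
  show "tau M \<in> extensional (darts M)"
    unfolding M_def cayley_hypermap_def by (simp only: hypermap.simps restrict_extensional)
next
  fix i g j h
  assume g: "g \<in> carrier G" and h: "h \<in> carrier G" and "tau M (arc i g) = tau M (arc j h)"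
  then have "arc i (b i \<otimes> g) = arc j (b j \<otimes> h)" by (simp add: tau_arc)
  then have bgh: "b i \<otimes> g = b j \<otimes> h" and ij: "i mod k = j mod k"
    using g by (simp_all only: arc_eq_iff m_closed b_closed)
  have "b i = b j" using ij H_eq_iff b_eq_if_H_eq by blast
  then show "g = h \<and> i mod k = j mod k" using bgh g h ij by simp
qed (simp add: tau_arc)

text \<open>
  From \<open>(g, i)\<close> one can change \<open>i\<close> freely by \<open>\<rho>\<close>, then replace \<open>g\<close> by \<open>b i \<otimes> g\<close> by \<open>\<tau>\<close>. So the
  set of vertices that occur in \<open>R\<close> is closed under left multiplication by the generators of \<open>G\<close>.
\<close>

lemma darts_connected:
  assumes base: "arc 0 \<one> \<in> R" and R: "R \<subseteq> darts M"
    and \<rho>: "\<And>d. d \<in> R \<Longrightarrow> rho M d \<in> R" and \<tau>: "\<And>d. d \<in> R \<Longrightarrow> tau M d \<in> R"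
  shows "R = darts M"
proof -
  have shift: "arc (i + n) g \<in> R" if "arc i g \<in> R" "g \<in> carrier G" for i n g
    using that(1)
  proof (induction n)
    case (Suc n)
    then show ?case using \<rho>[of "arc (i + n) g"] rho_arc[OF that(2)] by simp
  qed simp
  have any: "arc j g \<in> R" if "arc i g \<in> R" and g: "g \<in> carrier G" for i j g
  proof -
    \<comment> \<open>Indices only increase under \<open>\<rho>\<close>, so \<open>j\<close> is replaced by \<open>k * i + j \<ge> i\<close>.\<close>
    have "i + (k * i - i + j) = k * i + j"
      using k_pos by (cases k) auto
    then have "arc (k * i + j) g \<in> R"
      using shift[OF that, of "k * i - i + j"] by (simp only:)
    moreover have "arc (k * i + j) g = arc j g"
      using g by (simp add: arc_eq_iff)
    ultimately show ?thesis by simp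
  qed
  define S where "S = {g \<in> carrier G. arc 0 g \<in> R}"
  have finS: "finite S" using finite_carrier by (simp add: S_def)
  have S_mult: "b i \<otimes> g \<in> S" if "g \<in> S" for i g
    using that any[of 0 g i] \<tau>[of "arc i g"] tau_arc[of g i] any[of i "b i \<otimes> g" 0]
    by (simp add: S_def)
  \<comment> \<open>Closure under the inverses of the generators comes from finiteness: an injective self-map
    of \<open>S\<close> is onto.\<close>
  have S_surj: "(\<lambda>g. b i \<otimes> g) ` S = S" for i
  proof (rule endo_inj_surj[OF finS])
    show "(\<lambda>g. b i \<otimes> g) ` S \<subseteq> S" using S_mult by blast
    show "inj_on (\<lambda>g. b i \<otimes> g) S" by (auto simp: inj_on_def S_def)
  qed
  have S_inv: "inv (b i) \<otimes> g \<in> S" if g: "g \<in> S" for i g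
  proof -
    obtain h where h: "h \<in> S" "g = b i \<otimes> h" using S_surj[of i] g by blast
    then have "inv (b i) \<otimes> g = h" by (simp add: S_def m_assoc[symmetric])
    then show ?thesis using h by simp
  qed
  have "x \<otimes> g \<in> S" if "x \<in> generate G (range b)" "g \<in> S" for x g
    using that
  proof (induction arbitrary: g)
    case (eng h1 h2)
    have "h1 \<in> carrier G" "h2 \<in> carrier G"
      using eng.hyps generate_incl[of "range b"] b_closed by blast+
    then show ?case using eng by (simp add: m_assoc S_def)
  qed (auto simp: S_mult S_inv, simp add: S_def)
  moreover have "generate G (range b) = carrier G"
    using generates by (simp add: b_def[abs_def] \<phi>_def)
  moreover have "\<one> \<in> S" using base by (simp add: S_def)
  ultimately have "g \<in> S" if "g \<in> carrier G" for g using that by (metis r_one)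
  then have "arc i g \<in> R" if "g \<in> carrier G" for i g
    using that any by (auto simp: S_def)
  then show ?thesis using R by (auto elim!: dartsE)
qed

section \<open>The automorphisms\<close>

abbreviation R\<^sub>D :: "'a \<Rightarrow> 'a \<times> 'a set \<Rightarrow> 'a \<times> 'a set" where
  "R\<^sub>D \<equiv> right_mult_on_arcs G (darts M)"

abbreviation S\<^sub>D :: "nat \<Rightarrow> 'a \<times> 'a set \<Rightarrow> 'a \<times> 'a set" where
  "S\<^sub>D i \<equiv> automorphism_on_arcs (darts M) (\<phi> i)"

lemma right_mult_arc:
  assumes "g \<in> carrier G" "h \<in> carrier G"
  shows "R\<^sub>D h (arc i g) = arc i (g \<otimes> h)"
  using assms arc_in_darts[of g i] H_subset
  by (simp add: right_mult_on_arcs_def arc_def coset_mult_assoc)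

lemma automorphism_arc:
  assumes g: "g \<in> carrier G"
  shows "S\<^sub>D i (arc j g) = arc (i + j) (\<phi> i g)"
proof -
  have "\<phi> i ` (H j #> g) = (\<lambda>c. \<phi> i c \<otimes> \<phi> i g) ` H j"
    using g H_subset[of j] by (force simp: r_coset_def \<phi>_mult image_iff)
  also have "\<dots> = H (i + j) #> \<phi> i g"
    by (auto simp: r_coset_def \<phi>_image_H[symmetric])
  finally show ?thesis
    using arc_in_darts[OF g, of j] by (simp add: automorphism_on_arcs_def arc_def)
qed

lemma right_mult_Aut:
  assumes h: "h \<in> carrier G"
  shows "R\<^sub>D h \<in> hypermap_Aut M"
proof -
  have "R\<^sub>D h \<in> Bij (darts M)"
  proof (rule Bij_dartsI)
    show "R\<^sub>D h \<in> extensional (darts M)"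
      by (simp add: right_mult_on_arcs_def)
  qed (use h in \<open>simp_all add: right_mult_arc arc_eq_iff\<close>)
  then show ?thesis
    using h by (auto simp: hypermap_Aut_def right_mult_arc rho_arc tau_arc m_assoc elim!: dartsE)
qed

text \<open>
  The computation rests on \<open>\<phi> i (b j) = b (i + j)\<close>: the automorphism shifts the indices of the
  generators exactly as it shifts those of the arcs.
\<close>

lemma automorphism_Aut: "S\<^sub>D i \<in> hypermap_Aut M"
proof -
  have "S\<^sub>D i \<in> Bij (darts M)"
  proof (rule Bij_dartsI)
    show "S\<^sub>D i \<in> extensional (darts M)"
      by (simp add: automorphism_on_arcs_def)
  next
    fix j g l h
    assume g: "g \<in> carrier G" and h: "h \<in> carrier G" and "S\<^sub>D i (arc j g) = S\<^sub>D i (arc l h)"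
    then have "arc (i + j) (\<phi> i g) = arc (i + l) (\<phi> i h)" by (simp add: automorphism_arc)
    then have gh: "\<phi> i g = \<phi> i h" and il: "(i + j) mod k = (i + l) mod k"
      using g by (simp_all only: arc_eq_iff \<phi>_closed)
    have "g = h" using gh \<phi>_inj g h by (meson inj_onD)
    then show "g = h \<and> j mod k = l mod k"
      using il cong_add_lcancel_nat[of i j l k] by (simp add: cong_def)
  qed (simp add: automorphism_arc)
  then show ?thesis
    by (auto simp: hypermap_Aut_def automorphism_arc rho_arc tau_arc \<phi>_mult b_add elim!: dartsE)
qed

lemma regular_and_Aut:
  shows "regular_hypermap M"
    and "hypermap_Aut M = R\<^sub>D ` carrier G <#>\<^bsub>BijGroup (darts M)\<^esub> range S\<^sub>D"
proof -
  let ?A = "R\<^sub>D ` carrier G <#>\<^bsub>BijGroup (darts M)\<^esub> range S\<^sub>D"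
  have sub: "?A \<subseteq> hypermap_Aut M"
    using hypermap_Aut_compose[OF rho_Bij tau_Bij] right_mult_Aut automorphism_Aut by (auto simp: set_mult_def)
  have trans: "\<exists>f\<in>?A. f (arc 0 \<one>) = d" if d_in: "d \<in> darts M" for d
  proof -
    obtain i h where h: "h \<in> carrier G" and d: "d = arc i h" using d_in by (rule dartsE)
    have "R\<^sub>D h \<in> Bij (darts M)" "S\<^sub>D i \<in> Bij (darts M)"
      using right_mult_Aut[OF h] automorphism_Aut[of i] by (auto simp: hypermap_Aut_def)
    then have "(R\<^sub>D h \<otimes>\<^bsub>BijGroup (darts M)\<^esub> S\<^sub>D i) (arc 0 \<one>) = R\<^sub>D h (S\<^sub>D i (arc 0 \<one>))"
      by (simp add: BijGroup_mult_apply)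
    also have "\<dots> = d"
      using h d by (simp add: automorphism_arc right_mult_arc group_hom.hom_one[OF \<phi>_hom])
    finally show ?thesis
      using h by (auto simp: set_mult_def)
  qed
  note regular = regular_hypermapI[OF finite_darts rho_Bij tau_Bij arc_in_darts[OF one_closed]
      darts_connected sub trans]
  show "regular_hypermap M" by (rule regular)
  show "hypermap_Aut M = ?A" by (rule regular)
qed

end

theorem theorem3p15:
  fixes G :: "('a, 'b) monoid_scheme" (structure)
    and \<sigma> :: "'a \<Rightarrow> 'a" and a :: 'a and k t :: nat
    and Orb :: "'a set" and Xs :: "'a set set" and y :: "nat \<Rightarrow> 'a set"
    and \<rho>\<^sub>X :: "'a set \<Rightarrow> 'a set" and \<tau> :: "nat \<Rightarrow> 'a \<Rightarrow> 'a"
    and M :: "('a \<times> 'a set) hypermap" and \<Gamma> :: "'a hypergraph"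
  assumes "group G" and "finite (carrier G)"
    and "\<sigma> \<in> auto G" and "group.ord (AutoGroup G) \<sigma> = k"
    and "a \<in> carrier G" and "group.ord G a = t"
    and Orb: "Orb = {\<mu> a | \<mu>. \<mu> \<in> generate (AutoGroup G) {\<sigma>}}"
    and "card Orb = k"
    and "\<forall>i\<in>{1..k - 1}. generate G {a} \<noteq> generate G {(\<sigma> [^]\<^bsub>AutoGroup G\<^esub> i) a}"
    and y: "\<And>i. y i = generate G {(\<sigma> [^]\<^bsub>AutoGroup G\<^esub> i) a}"
    and Xs: "Xs = {generate G {b} | b. b \<in> Orb}"
    and \<rho>\<^sub>X: "\<rho>\<^sub>X = cycle_of_list (map y [1..<k + 1])"
    and \<tau>: "\<And>i. \<tau> i = cycle_of_list (map (\<lambda>n. (\<sigma> [^]\<^bsub>AutoGroup G\<^esub> i) (a [^] n)) [0..<t])"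
    and M: "M = cayley_hypermap G Xs k y \<rho>\<^sub>X \<tau>"
    and \<Gamma>: "\<Gamma> = cayley_hypergraph G Xs"
    and "generate G Orb = carrier G"
  shows "cayley_hypermap_data G Xs k y \<rho>\<^sub>X \<tau> \<and> regular_hypermap M \<and>
    simple_hypergraph \<Gamma> \<and>
    hypermap_Aut M =
      right_mult_on_arcs G (darts M) ` carrier G
        <#>\<^bsub>BijGroup (darts M)\<^esub>
      automorphism_on_arcs (darts M) ` generate (AutoGroup G) {\<sigma>}"
proof -
  interpret group G by fact
  interpret A: group "AutoGroup G" by (rule AutoGroup)
  let ?\<phi> = "\<lambda>i::nat. \<sigma> [^]\<^bsub>AutoGroup G\<^esub> i"
  have \<sigma>A: "\<sigma> \<in> carrier (AutoGroup G)"
    using \<open>\<sigma> \<in> auto G\<close> by (simp add: AutoGroup_def)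
  have gen_A: "generate (AutoGroup G) {\<sigma>} \<subseteq> auto G"
    using A.generate_incl[of "{\<sigma>}"] \<sigma>A by (simp add: AutoGroup_def)
  have "Orb \<subseteq> carrier G"
    unfolding Orb using gen_A \<open>a \<in> carrier G\<close> by (auto simp: auto_def hom_def)
  moreover have "Orb \<noteq> {}"
    unfolding Orb using generate.one by blast
  \<comment> \<open>\<open>k\<close> also counts a nonempty finite orbit, so \<open>\<sigma>\<close> has finite order and its natural powers
    exhaust \<open>\<langle>\<sigma>\<rangle>\<close>.\<close>
  ultimately have k_pos: "0 < k"
    using \<open>card Orb = k\<close> \<open>finite (carrier G)\<close> by (metis card_gt_0_iff finite_subset)
  then have powers: "generate (AutoGroup G) {\<sigma>} = range ?\<phi>"
    using A.generate_pow_nat[OF \<sigma>A] \<open>A.ord \<sigma> = k\<close> by auto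
  have Orb_range: "Orb = range (\<lambda>i. ?\<phi> i a)"
    unfolding Orb powers by auto
  interpret C: cyclic_subgroup_orbit G \<sigma> a k
    using assms k_pos Orb_range by unfold_locales auto
  have y_H: "y = C.H"
    by (simp add: fun_eq_iff y C.H_def C.b_def C.\<phi>_def)
  have Xs_H: "Xs = range C.H"
    unfolding Xs Orb_range by (auto simp: C.H_def C.b_def C.\<phi>_def)
  have \<rho>_C: "\<rho>\<^sub>X = C.\<rho>" by (simp add: \<rho>\<^sub>X y_H C.\<rho>_def)
  have \<tau>_C: "\<tau> = C.\<tau>"
    using \<open>ord a = t\<close> by (simp add: fun_eq_iff \<tau> C.\<tau>_def C.\<phi>_def)
  have M_C: "M = C.M" by (simp add: M C.M_def y_H Xs_H \<rho>_C \<tau>_C)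
  have "automorphism_on_arcs (darts M) ` generate (AutoGroup G) {\<sigma>} =
      range (\<lambda>i. automorphism_on_arcs (darts M) (C.\<phi> i))"
    unfolding powers C.\<phi>_def by (simp add: image_image)
  then show ?thesis
    using C.hypermap_data C.regular_and_Aut C.simple
    by (simp add: y_H Xs_H \<rho>_C \<tau>_C M_C \<Gamma>)
qed

end
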